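(* For any two constants $\eta\in[0,0.5)$ and $\delta\in[0,1]$, the property $\mathcal{D}^{\rm per}_{\eta,\delta}=\bigcup_{x^*\in\{0,1\}^n}\mathcal{D}^{\rm per}_{\eta,\delta}(x^* )$ can be tested in the DoHO model with $\mathrm{poly}(1/\epsilon)$ queries.
   Context: For $x^*\in\{0,1\}^n$, $\mathcal{D}^{\rm per}_{\eta,\delta}(x^* )$ is the set of distributions $X$ over $\{0,1\}^n$ such that (1) $\Pr[X_i\neq x^*_i]\le\eta$ for every $i\in[n]$, and (2) $\Pr[|\{i\in[n]:X_i\neq x^*_i\}|\le\delta n]=1$. For $x,y\in\{0,1\}^n$ let $\Delta_H(x,y)=\frac1n|\{i:x_i\neq y_i\}|$. The distance between distributions $P,Q$ over $\{0,1\}^n$ is $\min\sum_{x,y}w_{x,y}\Delta_H(x,y)$ over nonnegative $w_{x,y}$ with $\sum_y w_{x,y}=P(x)$, $\sum_x w_{x,y}=Q(y)$; $\epsilon$-far from a set means distance greater than $\epsilon$ to every member. A tester in the DoHO model for a set $\mathcal{E}$ of distributions over $\{0,1\}^n$ gets $n,\epsilon$ and oracle access to independent samples of an unknown distribution $P$, may query individual bits of samples, and must accept with probability at least $2/3$ if $P\in\mathcal{E}$ and reject with probability at least $2/3$ if $P$ is $\epsilon$-far from $\mathcal{E}$; its query complexity is the total number of bit queries. *)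

theory Defs
  imports "HOL-Probability.Probability" "HOL-Computational_Algebra.Polynomial"
begin

definition cube :: "nat \<Rightarrow> bool list set" where
  "cube n = {x. length x = n}"

definition distributions :: "nat \<Rightarrow> bool list pmf set" where
  "distributions n = {P. set_pmf P \<subseteq> cube n}"

definition diff_set :: "nat \<Rightarrow> bool list \<Rightarrow> bool list \<Rightarrow> nat set" where
  "diff_set n x y = {i. i < n \<and> x ! i \<noteq> y ! i}"

definition rel_hamming :: "nat \<Rightarrow> bool list \<Rightarrow> bool list \<Rightarrow> real" where
  "rel_hamming n x y = real (card (diff_set n x y)) / real n"

definition couplings ::
    "nat \<Rightarrow> bool list pmf \<Rightarrow> bool list pmf \<Rightarrow> (bool list \<Rightarrow> bool list \<Rightarrow> real) set" where
  "couplings n P Q = {w.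
     (\<forall>x\<in>cube n. \<forall>y\<in>cube n. 0 \<le> w x y) \<and>
     (\<forall>x\<in>cube n. (\<Sum>y\<in>cube n. w x y) = pmf P x) \<and>
     (\<forall>y\<in>cube n. (\<Sum>x\<in>cube n. w x y) = pmf Q y)}"

text \<open>
  For distributions over \<open>cube n\<close> the infimum below is a minimum: it is the value of a linear
  program over a nonempty polytope whose objective is bounded below.
\<close>

definition dist_distance :: "nat \<Rightarrow> bool list pmf \<Rightarrow> bool list pmf \<Rightarrow> real" where
  "dist_distance n P Q =
     (INF w\<in>couplings n P Q. \<Sum>x\<in>cube n. \<Sum>y\<in>cube n. w x y * rel_hamming n x y)"

definition far_from :: "nat \<Rightarrow> real \<Rightarrow> bool list pmf \<Rightarrow> bool list pmf set \<Rightarrow> bool" where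
  "far_from n \<epsilon> P E \<longleftrightarrow> (\<forall>Q\<in>E. dist_distance n P Q > \<epsilon>)"

definition D_per_at :: "real \<Rightarrow> real \<Rightarrow> nat \<Rightarrow> bool list \<Rightarrow> bool list pmf set" where
  "D_per_at \<eta> \<delta> n xs = {X \<in> distributions n.
     (\<forall>i<n. measure_pmf.prob X {x. x ! i \<noteq> xs ! i} \<le> \<eta>) \<and>
     measure_pmf.prob X {x. real (card (diff_set n x xs)) \<le> \<delta> * real n} = 1}"

definition D_per :: "real \<Rightarrow> real \<Rightarrow> nat \<Rightarrow> bool list pmf set" where
  "D_per \<eta> \<delta> n = (\<Union>xs\<in>cube n. D_per_at \<eta> \<delta> n xs)"

text \<open>
  A deterministic adaptive strategy. \<open>Query k j t0 t1\<close> asks for bit \<open>j\<close> of the \<open>k\<close>-th sample and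
  continues with \<open>t0\<close> or \<open>t1\<close> if the answer is 0 or 1 respectively; \<open>Decide True\<close> accepts.
\<close>

datatype strategy = Decide bool | Query nat nat strategy strategy

primrec verdict :: "strategy \<Rightarrow> (nat \<Rightarrow> bool list) \<Rightarrow> bool" where
  "verdict (Decide b) \<omega> = b"
| "verdict (Query k j t0 t1) \<omega> = (if \<omega> k ! j then verdict t1 \<omega> else verdict t0 \<omega>)"

primrec legal :: "nat \<Rightarrow> nat \<Rightarrow> strategy \<Rightarrow> bool" where
  "legal s n (Decide b) \<longleftrightarrow> True"
| "legal s n (Query k j t0 t1) \<longleftrightarrow> k < s \<and> j < n \<and> legal s n t0 \<and> legal s n t1"

text \<open>Worst-case number of bit queries.\<close>

primrec num_queries :: "strategy \<Rightarrow> nat" where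
  "num_queries (Decide b) = 0"
| "num_queries (Query k j t0 t1) = Suc (max (num_queries t0) (num_queries t1))"

text \<open>
  A randomized algorithm is a distribution over deterministic strategies (the internal coins are
  tossed in advance, independently of the samples). The \<open>s\<close> samples are independent draws
  from \<open>P\<close>.
\<close>

definition outcome :: "nat \<Rightarrow> strategy pmf \<Rightarrow> bool list pmf \<Rightarrow> bool pmf" where
  "outcome s T P =
     bind_pmf T (\<lambda>t. map_pmf (verdict t) (Pi_pmf {..<s} [] (\<lambda>_. P)))"

text \<open>
  \<open>E n\<close> is the part of the property consisting of distributions over \<open>cube n\<close>;
  \<open>S n \<epsilon>\<close> is the number of samples and \<open>T n \<epsilon>\<close> the randomized strategy on input \<open>n, \<epsilon>\<close>.
\<close>

definition DoHO_tester ::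
    "(nat \<Rightarrow> bool list pmf set) \<Rightarrow> (nat \<Rightarrow> real \<Rightarrow> nat) \<Rightarrow> (nat \<Rightarrow> real \<Rightarrow> strategy pmf) \<Rightarrow> bool" where
  "DoHO_tester E S T \<longleftrightarrow> (\<forall>n \<epsilon>. n \<ge> 1 \<longrightarrow> \<epsilon> > 0 \<longrightarrow>
     (\<forall>t\<in>set_pmf (T n \<epsilon>). legal (S n \<epsilon>) n t) \<and>
     (\<forall>P\<in>E n. pmf (outcome (S n \<epsilon>) (T n \<epsilon>) P) True \<ge> 2/3) \<and>
     (\<forall>P\<in>distributions n. far_from n \<epsilon> P (E n) \<longrightarrow>
        pmf (outcome (S n \<epsilon>) (T n \<epsilon>) P) False \<ge> 2/3))"

definition query_complexity_le ::
    "(nat \<Rightarrow> real \<Rightarrow> strategy pmf) \<Rightarrow> (nat \<Rightarrow> real \<Rightarrow> real) \<Rightarrow> bool" where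
  "query_complexity_le T q \<longleftrightarrow>
     (\<forall>n \<epsilon>. n \<ge> 1 \<longrightarrow> \<epsilon> > 0 \<longrightarrow> (\<forall>t\<in>set_pmf (T n \<epsilon>). real (num_queries t) \<le> q n \<epsilon>))"

definition DoHO_testable_with ::
    "(nat \<Rightarrow> bool list pmf set) \<Rightarrow> (nat \<Rightarrow> real \<Rightarrow> real) \<Rightarrow> bool" where
  "DoHO_testable_with E q \<longleftrightarrow> (\<exists>S T. DoHO_tester E S T \<and> query_complexity_le T q)"

end

theory Submission imports Defs begin

text \<open>
  Since \<open>\<eta> < 1/2\<close>, the centre must be the coordinatewise majority of \<open>P\<close>, so it can be estimated
  on a few random coordinates. With accuracy \<open>\<tau> = 1 / K\<close> of order \<open>\<epsilon>\<close>, the tester reads random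
  coordinates of many samples and checks that every sampled coordinate has minority frequency at
  most \<open>\<eta> + \<tau>\<close>, and that the first few samples are within \<open>\<lfloor>\<delta> n\<rfloor> / n + \<tau>\<close> of the estimated
  centre on the sampled coordinates. If \<open>P\<close> survives with probability above \<open>1/3\<close>, then few
  coordinates have error above \<open>\<eta> + 2 \<tau>\<close> and samples rarely are at distance above
  \<open>\<lfloor>\<delta> n\<rfloor> / n + 2 \<tau>\<close> from the centre. Such a \<open>P\<close> is repaired at cost \<open>5 \<tau>\<close>: correct errors,
  those at bad coordinates first, until at most \<open>\<lfloor>\<delta> n\<rfloor>\<close> remain, and then replace the whole string
  by the centre with probability \<open>2 \<tau> / (\<eta> + 2 \<tau>)\<close>, which scales every coordinate error down
  to \<open>\<eta>\<close>. Using \<open>\<lfloor>\<delta> n\<rfloor> / n\<close> in place of \<open>\<delta>\<close> avoids a rounding loss of \<open>1 / n\<close>.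
\<close>

section \<open>Couplings and the distance to the property\<close>

lemma finite_cube: "finite (cube n)"
proof -
  have "cube n = {x. set x \<subseteq> (UNIV :: bool set) \<and> length x = n}"
    by (auto simp: cube_def)
  then show ?thesis
    using finite_lists_length_eq[of "UNIV :: bool set" n] by simp
qed

lemma finite_set_pmf_distributions: "P \<in> distributions n \<Longrightarrow> finite (set_pmf P)"
  using finite_cube finite_subset by (auto simp: distributions_def)

lemma rel_hamming_nonneg: "0 \<le> rel_hamming n x y"
  by (simp add: rel_hamming_def)

text \<open>The joint law of \<open>f\<close> and \<open>g\<close> under \<open>M\<close> is a
  coupling, so its cost bounds the infimum. Repairs can then be described as random experiments
  instead of weight matrices.\<close>

lemma dist_distance_le_expectation:
  assumes P: "map_pmf f M = P" "P \<in> distributions n"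
    and Q: "map_pmf g M = Q" "Q \<in> distributions n"
  shows "dist_distance n P Q \<le> measure_pmf.expectation M (\<lambda>z. rel_hamming n (f z) (g z))"
proof -
  define W where "W = map_pmf (\<lambda>z. (f z, g z)) M"
  define w where "w = (\<lambda>x y. pmf W (x, y))"
  have fst: "map_pmf fst W = P" and snd: "map_pmf snd W = Q"
    by (simp_all add: W_def pmf.map_comp o_def P Q)
  have supp: "set_pmf W \<subseteq> cube n \<times> cube n"
  proof
    fix z assume z: "z \<in> set_pmf W"
    have "fst z \<in> set_pmf P" "snd z \<in> set_pmf Q"
      unfolding fst[symmetric] snd[symmetric] using z by auto
    then show "z \<in> cube n \<times> cube n"
      using P Q by (cases z) (auto simp: distributions_def)
  qed
  have "(\<Sum>y\<in>cube n. w x y) = pmf P x" for x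
  proof -
    have "(\<Sum>y\<in>cube n. w x y) = (\<Sum>z\<in>{x} \<times> cube n. pmf W z)"
      using sum.cartesian_product[of "\<lambda>x y. pmf W (x, y)" "cube n" "{x}"] by (simp add: w_def)
    also have "\<dots> = measure_pmf.prob W ({x} \<times> cube n)"
      by (simp add: measure_measure_pmf_finite finite_cube)
    \<comment> \<open>Both marginals live on the cube, so \<open>W\<close> has no mass outside
      \<open>cube n \<times> cube n\<close>.\<close>
    also have "\<dots> = measure_pmf.prob W (fst -` {x})"
      by (rule measure_prob_cong_0) (use supp in \<open>auto simp: set_pmf_eq\<close>)
    also have "\<dots> = measure_pmf.prob P {x}"
      by (simp add: fst[symmetric])
    finally show ?thesis
      by (simp add: measure_pmf_single)
  qed
  moreover have "(\<Sum>x\<in>cube n. w x y) = pmf Q y" for y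
  proof -
    have "(\<Sum>x\<in>cube n. w x y) = (\<Sum>z\<in>cube n \<times> {y}. pmf W z)"
      using sum.cartesian_product[of "\<lambda>x y. pmf W (x, y)" "{y}" "cube n"] by (simp add: w_def)
    also have "\<dots> = measure_pmf.prob W (cube n \<times> {y})"
      by (simp add: measure_measure_pmf_finite finite_cube)
    also have "\<dots> = measure_pmf.prob W (snd -` {y})"
      by (rule measure_prob_cong_0) (use supp in \<open>auto simp: set_pmf_eq\<close>)
    also have "\<dots> = measure_pmf.prob Q {y}"
      by (simp add: snd[symmetric])
    finally show ?thesis
      by (simp add: measure_pmf_single)
  qed
  ultimately have w: "w \<in> couplings n P Q"
    by (simp add: couplings_def w_def)
  have "dist_distance n P Q \<le> (\<Sum>x\<in>cube n. \<Sum>y\<in>cube n. w x y * rel_hamming n x y)"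
    unfolding dist_distance_def
  proof (rule cINF_lower[OF _ w])
    show "bdd_below ((\<lambda>w. \<Sum>x\<in>cube n. \<Sum>y\<in>cube n. w x y * rel_hamming n x y) ` couplings n P Q)"
      by (rule bdd_belowI[of _ 0])
        (auto simp: couplings_def intro!: sum_nonneg mult_nonneg_nonneg rel_hamming_nonneg)
  qed
  also have "\<dots> = (\<Sum>z\<in>cube n \<times> cube n. pmf W z *\<^sub>R rel_hamming n (fst z) (snd z))"
    by (simp add: sum.cartesian_product w_def case_prod_unfold)
  also have "\<dots> = measure_pmf.expectation W (\<lambda>z. rel_hamming n (fst z) (snd z))"
    by (rule integral_measure_pmf[symmetric]) (use finite_cube supp in auto)
  also have "\<dots> = measure_pmf.expectation M (\<lambda>z. rel_hamming n (f z) (g z))"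
    by (simp add: W_def)
  finally show ?thesis .
qed

text \<open>Cost budget: partial correction moves strings outside \<open>F\<close> by at most
  \<open>2 * \<tau>\<close>, strings in \<open>F\<close> contribute at most \<open>\<tau>\<close>,
  and the random reset to the centre adds at most \<open>2 * \<tau>\<close>.\<close>

lemma close_to_D_per_at:
  fixes \<eta> \<delta> \<tau> :: real
  assumes P: "P \<in> distributions n" and xs: "xs \<in> cube n" and n: "n \<ge> 1"
    and \<eta>: "0 \<le> \<eta>" and \<delta>: "0 \<le> \<delta>" and \<tau>: "0 < \<tau>"
    and bad: "card {i. i < n \<and> measure_pmf.prob P {x. x ! i \<noteq> xs ! i} > \<eta> + 2 * \<tau>} \<le> \<tau> * n"
    and far: "measure_pmf.prob P {x. rel_hamming n x xs > \<lfloor>\<delta> * n\<rfloor> / n + 2 * \<tau>} \<le> \<tau>"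
  shows "\<exists>Q\<in>D_per_at \<eta> \<delta> n xs. dist_distance n P Q \<le> 5 * \<tau>"
proof -
  define Bad where "Bad = {i. i < n \<and> measure_pmf.prob P {x. x ! i \<noteq> xs ! i} > \<eta> + 2 * \<tau>}"
  define d where "d = nat \<lfloor>\<delta> * n\<rfloor>"
  define F where "F = {x. rel_hamming n x xs > \<lfloor>\<delta> * n\<rfloor> / n + 2 * \<tau>}"
  have d: "real d = \<lfloor>\<delta> * n\<rfloor>" "real d \<le> \<delta> * n"
    using \<delta> by (simp_all add: d_def)
  have fin: "finite (diff_set n x y)" for x y
    by (simp add: diff_set_def)
  have finB: "finite Bad"
    by (simp add: Bad_def)
  \<comment> \<open>\<open>S x\<close> is the set of errors to keep: none in \<open>Bad\<close>, and
    as many of the others as the budget \<open>d\<close> permits.\<close>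
  have "\<exists>S \<subseteq> diff_set n x xs - Bad. card S = min d (card (diff_set n x xs - Bad))" for x
    by (metis min.cobounded2 obtain_subset_with_card_n)
  then obtain S where S: "\<And>x. S x \<subseteq> diff_set n x xs - Bad"
      and cS: "\<And>x. card (S x) = min d (card (diff_set n x xs - Bad))"
    by metis
  have Sn: "i < n" "x ! i \<noteq> xs ! i" "i \<notin> Bad" if "i \<in> S x" for i x
    using S[of x] that by (auto simp: diff_set_def)
  have finS: "finite (S x)" for x
    using S[of x] fin[of x xs] finite_subset by blast
  define g where "g = (\<lambda>x. map (\<lambda>i. if i \<in> S x then \<not> xs ! i else xs ! i) [0..<n])"
  have g_nth: "g x ! i = (if i \<in> S x then \<not> xs ! i else xs ! i)" if "i < n" for i x
    using that by (simp add: g_def)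
  have diff_g: "diff_set n (g x) xs = S x" for x
    using Sn(1) by (auto simp: diff_set_def g_nth split: if_splits)
  have diff_xg: "diff_set n x (g x) = diff_set n x xs - S x" for x
    using Sn by (auto simp: diff_set_def g_nth split: if_splits)
  \<comment> \<open>The reset probability solves
    \<open>(1 - l) * (\<eta> + 2 * \<tau>) = \<eta>\<close>; its cost is then
    \<open>l * (\<eta> + 2 * \<tau>) = 2 * \<tau>\<close>. Since \<open>\<tau> > 0\<close>, this
    also covers \<open>\<eta> = 0\<close>, where \<open>l = 1\<close>.\<close>
  define l where "l = 2 * \<tau> / (\<eta> + 2 * \<tau>)"
  have l: "0 \<le> l" "l \<le> 1" "l * (\<eta> + 2 * \<tau>) = 2 * \<tau>" "(1 - l) * (\<eta> + 2 * \<tau>) = \<eta>"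
    using \<eta> \<tau> by (auto simp: l_def field_simps)
  define M where "M = pair_pmf P (bernoulli_pmf l)"
  define h where "h = (\<lambda>z. if snd z then xs else g (fst z))"
  define Q where "Q = map_pmf h M"
  have PS: "measure_pmf.prob P {x. i \<in> S x} \<le> \<eta> + 2 * \<tau>" if "i < n" for i
  proof (cases "i \<in> Bad")
    case True
    then have "{x. i \<in> S x} = {}"
      using Sn by blast
    then show ?thesis
      using \<eta> \<tau> by simp
  next
    case False
    have "measure_pmf.prob P {x. i \<in> S x} \<le> measure_pmf.prob P {x. x ! i \<noteq> xs ! i}"
      by (rule measure_pmf.finite_measure_mono) (use Sn in auto)
    also have "\<dots> \<le> \<eta> + 2 * \<tau>"
      using False that by (simp add: Bad_def)
    finally show ?thesis .
  qed
  have PM: "measure_pmf.prob M ({x. i \<in> S x} \<times> {b}) =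
      measure_pmf.prob P {x. i \<in> S x} * (if b then l else 1 - l)" for i b
    unfolding M_def using l by (subst measure_pmf_prob_product) (simp_all add: measure_pmf_single)
  have finM: "finite (set_pmf M)"
    using finite_set_pmf_distributions[OF P] by (auto simp: M_def)
  have int: "integrable M f" for f :: "bool list \<times> bool \<Rightarrow> real"
    using integrable_measure_pmf_finite[OF finM] .
  have QE: "Q \<in> D_per_at \<eta> \<delta> n xs"
    unfolding D_per_at_def
  proof (intro CollectI conjI allI impI)
    show "Q \<in> distributions n"
      using xs by (auto simp: distributions_def Q_def h_def g_def cube_def)
  next
    fix i assume i: "i < n"
    have "measure_pmf.prob Q {x. x ! i \<noteq> xs ! i} = measure_pmf.prob M ({x. i \<in> S x} \<times> {False})"
      unfolding Q_def measure_map_pmf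
      by (rule arg_cong[where f = "measure_pmf.prob M"])
        (use i in \<open>auto simp: h_def g_nth split: if_splits\<close>)
    also have "\<dots> \<le> (\<eta> + 2 * \<tau>) * (1 - l)"
      unfolding PM using PS[OF i] l by (auto intro!: mult_right_mono)
    finally show "measure_pmf.prob Q {x. x ! i \<noteq> xs ! i} \<le> \<eta>"
      using l by (simp add: mult.commute)
  next
    have "real (card (diff_set n (h z) xs)) \<le> \<delta> * n" for z
    proof -
      have "card (diff_set n (h z) xs) \<le> d"
        using cS[of "fst z"] by (auto simp: h_def diff_g) (simp add: diff_set_def)
      then show ?thesis
        using d by linarith
    qed
    then show "measure_pmf.prob Q {x. real (card (diff_set n x xs)) \<le> \<delta> * real n} = 1"
      by (simp add: Q_def)
  qed
  \<comment> \<open>Off \<open>F\<close>, either \<open>S x\<close> exhausts the budget and at most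
    \<open>2 * \<tau> * n\<close> errors exceed \<open>d\<close>, or it keeps every error outside
    \<open>Bad\<close> and only errors in \<open>Bad\<close> are corrected. On \<open>F\<close> the
    trivial bound 1 is used.\<close>
  have rg: "rel_hamming n x (g x) \<le> 2 * \<tau> + indicator F x" for x
  proof (cases "x \<in> F")
    case True
    have "card (diff_set n x (g x)) \<le> card {..<n}"
      by (rule card_mono) (auto simp: diff_set_def)
    then have "rel_hamming n x (g x) \<le> 1"
      using n by (simp add: rel_hamming_def)
    then show ?thesis
      using True \<tau> by simp
  next
    case False
    let ?D = "diff_set n x xs"
    have 1: "card (diff_set n x (g x)) = card ?D - card (S x)"
      unfolding diff_xg using S[of x] finS by (intro card_Diff_subset) auto
    have "card ?D \<le> card ((?D - Bad) \<union> Bad)"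
      by (rule card_mono) (use fin finB in auto)
    also have "\<dots> \<le> card (?D - Bad) + card Bad"
      by (rule card_Un_le)
    finally have 2: "card ?D \<le> card (?D - Bad) + card Bad" .
    have "card ?D / n \<le> (d + 2 * \<tau> * n) / n"
      using False n d by (simp add: F_def rel_hamming_def add_divide_distrib)
    then have 3: "real (card ?D) \<le> d + 2 * \<tau> * n"
      using n by (simp add: divide_le_cancel)
    have 4: "real (card Bad) \<le> \<tau> * n"
      using bad by (simp add: Bad_def)
    have "real (card ?D - card (S x)) \<le> 2 * \<tau> * n"
    proof (cases "card (S x) = d")
      case True
      then show ?thesis
        using 3 \<tau> by (cases "card ?D \<le> d") (auto simp: of_nat_diff)
    next
      case False
      then have "card (S x) = card (?D - Bad)"
        using cS[of x] by linarith
      then have "card ?D - card (S x) \<le> card Bad"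
        using 2 by linarith
      then have "real (card ?D - card (S x)) \<le> \<tau> * n"
        using 4 by linarith
      also have "\<dots> \<le> 2 * \<tau> * n"
        using \<tau> by simp
      finally show ?thesis .
    qed
    then have "rel_hamming n x (g x) \<le> 2 * \<tau>"
      using n by (simp add: rel_hamming_def 1 field_simps)
    then show ?thesis
      using False by simp
  qed
  \<comment> \<open>A reset also removes the errors in \<open>S x\<close>. Counting them by
    indicators lets linearity of expectation reduce their cost to the single-coordinate bounds
    \<open>PS\<close>.\<close>
  have pointwise: "rel_hamming n (fst z) (h z) \<le>
      2 * \<tau> + indicator (F \<times> UNIV) z + (\<Sum>i<n. indicator ({x. i \<in> S x} \<times> {True}) z) / n" for z
  proof (cases z)
    case (Pair x b)
    show ?thesis
    proof (cases b)
      case False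
      then show ?thesis
        using rg[of x] Pair by (simp add: h_def indicator_def)
    next
      case True
      have "(\<Sum>i<n. indicator ({x. i \<in> S x} \<times> {True}) z) = (\<Sum>i<n. if i \<in> S x then 1 else (0::real))"
        using Pair True by (intro sum.cong) auto
      also have "\<dots> = real (card ({..<n} \<inter> S x))"
        by (simp add: sum.If_cases Int_def)
      also have "{..<n} \<inter> S x = S x"
        using Sn by auto
      finally have sum: "(\<Sum>i<n. indicator ({x. i \<in> S x} \<times> {True}) z) = real (card (S x))" .
      have "card (diff_set n x xs) = card (diff_set n x (g x)) + card (S x)"
        unfolding diff_xg using card_Diff_subset[OF finS[of x], of "diff_set n x xs"] S[of x]
          card_mono[OF fin[of x xs], of "S x"] by fastforce
      then have "rel_hamming n x xs = rel_hamming n x (g x) + card (S x) / n"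
        by (simp add: rel_hamming_def add_divide_distrib)
      then show ?thesis
        unfolding sum using rg[of x] Pair True by (simp add: h_def indicator_def)
    qed
  qed
  have "dist_distance n P Q \<le> measure_pmf.expectation M (\<lambda>z. rel_hamming n (fst z) (h z))"
    using QE P by (intro dist_distance_le_expectation)
      (auto simp: M_def map_fst_pair_pmf Q_def D_per_at_def)
  also have "\<dots> \<le> measure_pmf.expectation M (\<lambda>z. 2 * \<tau> + indicator (F \<times> UNIV) z +
      (\<Sum>i<n. indicator ({x. i \<in> S x} \<times> {True}) z) / n)"
    by (rule integral_mono) (use int pointwise in auto)
  also have "\<dots> = 2 * \<tau> + measure_pmf.prob M (F \<times> UNIV) +
      (\<Sum>i<n. measure_pmf.prob M ({x. i \<in> S x} \<times> {True})) / n"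
    using int by (simp add: Bochner_Integration.integral_add Bochner_Integration.integral_sum)
  also have "measure_pmf.prob M (F \<times> UNIV) = measure_pmf.prob P F"
    unfolding M_def by (subst measure_pmf_prob_product) auto
  also have "(\<Sum>i<n. measure_pmf.prob M ({x. i \<in> S x} \<times> {True})) \<le> (\<Sum>i<n. 2 * \<tau>)"
  proof (rule sum_mono)
    fix i assume "i \<in> {..<n}"
    then have "measure_pmf.prob P {x. i \<in> S x} * l \<le> (\<eta> + 2 * \<tau>) * l"
      using PS l by (intro mult_right_mono) auto
    then show "measure_pmf.prob M ({x. i \<in> S x} \<times> {True}) \<le> 2 * \<tau>"
      using l by (simp add: PM mult.commute)
  qed
  finally have "dist_distance n P Q \<le> 2 * \<tau> + measure_pmf.prob P F + (\<Sum>i<n. 2 * \<tau>) / n"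
    by (simp add: divide_right_mono)
  then have "dist_distance n P Q \<le> 5 * \<tau>"
    using far n by (simp add: F_def)
  then show ?thesis
    using QE by blast
qed

section \<open>Probability estimates\<close>

text \<open>Averaging over the first component: a bound that holds for each fixed value of it
  survives integration.\<close>

lemma prob_pair_pmf_le:
  assumes "\<And>x. x \<in> set_pmf p \<Longrightarrow> measure_pmf.prob q {y. R x y} \<le> c" and "0 \<le> c"
  shows "measure_pmf.prob (pair_pmf p q) {z. R (fst z) (snd z)} \<le> c"
proof -
  have "emeasure (pair_pmf p q) {z. R (fst z) (snd z)} =
      (\<integral>\<^sup>+x. \<integral>\<^sup>+y. indicator {z. R (fst z) (snd z)} (x, y) \<partial>q \<partial>p)"
    by (simp flip: nn_integral_indicator add: nn_integral_pair_pmf')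
  also have "\<dots> = (\<integral>\<^sup>+x. emeasure q {y. R x y} \<partial>p)"
    by (simp flip: nn_integral_indicator add: indicator_def)
  also have "\<dots> \<le> (\<integral>\<^sup>+x. ennreal c \<partial>p)"
    using assms by (intro nn_integral_mono_AE)
      (auto simp: AE_measure_pmf_iff measure_pmf.emeasure_eq_measure)
  finally show ?thesis
    using assms(2) by (simp add: measure_pmf.emeasure_eq_measure)
qed

lemma prob_pair_pmf_le':
  assumes "\<And>y. y \<in> set_pmf q \<Longrightarrow> measure_pmf.prob p {x. R x y} \<le> c" and "0 \<le> c"
  shows "measure_pmf.prob (pair_pmf p q) {z. R (fst z) (snd z)} \<le> c"
proof -
  have "measure_pmf.prob (pair_pmf q p) {z. R (snd z) (fst z)} \<le> c"
    using assms by (rule prob_pair_pmf_le[where R = "\<lambda>y x. R x y"])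
  then show ?thesis
    by (subst pair_commute_pmf) (simp add: vimage_def case_prod_unfold)
qed

lemma prob_bex_le:
  fixes r :: nat and c :: real
  assumes "\<And>k. k < r \<Longrightarrow> measure_pmf.prob p {x. R k x} \<le> c"
  shows "measure_pmf.prob p {x. \<exists>k<r. R k x} \<le> r * c"
proof -
  have "measure_pmf.prob p {x. \<exists>k<r. R k x} = measure_pmf.prob p (\<Union>k<r. {x. R k x})"
    by (rule arg_cong[where f = "measure_pmf.prob p"]) auto
  also have "\<dots> \<le> (\<Sum>k<r. measure_pmf.prob p {x. R k x})"
    by (rule measure_pmf.finite_measure_subadditive_finite) auto
  also have "\<dots> \<le> (\<Sum>k<r. c)"
    using assms by (intro sum_mono) auto
  finally show ?thesis by simp
qed

lemma prob_Un3_le: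
  assumes "X \<subseteq> A \<union> B \<union> C" "measure_pmf.prob M A \<le> a" "measure_pmf.prob M B \<le> b"
    "measure_pmf.prob M C \<le> c"
  shows "measure_pmf.prob M X \<le> a + b + c"
proof -
  have "measure_pmf.prob M X \<le> measure_pmf.prob M (A \<union> B \<union> C)"
    using assms(1) by (intro measure_pmf.finite_measure_mono) auto
  also have "\<dots> \<le> measure_pmf.prob M (A \<union> B) + measure_pmf.prob M C"
    by (rule measure_Un_le) auto
  also have "measure_pmf.prob M (A \<union> B) \<le> measure_pmf.prob M A + measure_pmf.prob M B"
    by (rule measure_Un_le) auto
  finally show ?thesis
    using assms by linarith
qed

lemma map_pmf_bernoulli: "map_pmf (\<lambda>x. x \<in> B) p = bernoulli_pmf (measure_pmf.prob p B)"
proof (rule pmf_eqI)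
  fix b
  show "pmf (map_pmf (\<lambda>x. x \<in> B) p) b = pmf (bernoulli_pmf (measure_pmf.prob p B)) b"
  proof (cases b)
    case True
    then show ?thesis
      by (simp add: pmf_map vimage_def)
  next
    case False
    have "(\<lambda>x. x \<in> B) -` {False} = UNIV - B"
      by auto
    then show ?thesis
      using False measure_pmf.prob_compl[of B p] by (simp add: pmf_map)
  qed
qed

text \<open>The count is binomial, so Hoeffding's inequality applies. The exponential is then
  weakened by \<open>y \<le> exp y\<close>: an inverse-linear bound suffices for polynomial
  complexity and allows explicit powers of \<open>K\<close> as sample sizes.\<close>

lemma prob_frequency_deviation_le:
  assumes N: "0 < (N::nat)" and \<tau>: "0 < (\<tau>::real)"
  shows "measure_pmf.prob (Pi_pmf {..<N} dflt (\<lambda>_. p))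
      {\<omega>. \<bar>card {k\<in>{..<N}. \<omega> k \<in> B} / N - measure_pmf.prob p B\<bar> > \<tau>} \<le> 1 / (N * \<tau>\<^sup>2)"
    (is "measure_pmf.prob ?M ?E \<le> _")
proof -
  define \<beta> where "\<beta> = measure_pmf.prob p B"
  interpret binomial_distribution N \<beta>
    by unfold_locales (simp add: \<beta>_def)
  have "binomial_pmf N \<beta> = map_pmf (\<lambda>f. card {k\<in>{..<N}. f k})
      (Pi_pmf {..<N} (dflt \<in> B) (\<lambda>_. bernoulli_pmf \<beta>))"
    by (rule binomial_pmf_altdef') (auto simp: \<beta>_def)
  also have "Pi_pmf {..<N} (dflt \<in> B) (\<lambda>_. bernoulli_pmf \<beta>) = map_pmf (\<lambda>h. (\<lambda>x. x \<in> B) \<circ> h) ?M"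
    unfolding \<beta>_def map_pmf_bernoulli[symmetric] by (rule Pi_pmf_map) auto
  finally have eq: "binomial_pmf N \<beta> = map_pmf (\<lambda>\<omega>. card {k\<in>{..<N}. \<omega> k \<in> B}) ?M"
    by (simp add: pmf.map_comp o_def)
  have "measure_pmf.prob ?M ?E \<le> measure_pmf.prob (binomial_pmf N \<beta>) {x. \<bar>x / N - \<beta>\<bar> \<ge> \<tau>}"
    unfolding eq measure_map_pmf
    by (rule measure_pmf.finite_measure_mono) (auto simp: \<beta>_def)
  also have "\<dots> \<le> 2 * exp (- 2 * N * \<tau>\<^sup>2)"
    using prob_abs_ge'[OF N, of \<tau>] \<tau> by simp
  also have "\<dots> = 2 / exp (2 * N * \<tau>\<^sup>2)"
    by (simp add: exp_minus divide_inverse)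
  also have "\<dots> \<le> 2 / (2 * N * \<tau>\<^sup>2)"
    using exp_ge_add_one_self[of "2 * N * \<tau>\<^sup>2"] N \<tau>
    by (intro divide_left_mono order_trans[OF _ exp_ge_add_one_self]) auto
  finally show ?thesis by simp
qed

text \<open>By independence the probability is \<open>(1 - \<beta>) ^ r\<close>, at most
  \<open>exp (- r * \<tau>)\<close>; only the first \<open>r\<close> of the \<open>s\<close> draws
  are constrained.\<close>

lemma prob_all_avoid_le:
  assumes r: "r \<le> (s::nat)" and B: "\<tau> \<le> measure_pmf.prob p B" and \<tau>: "0 < (\<tau>::real)"
  shows "measure_pmf.prob (Pi_pmf {..<s} dflt (\<lambda>_. p)) {\<omega>. \<forall>k<r. \<omega> k \<notin> B} \<le> 1 / (1 + r * \<tau>)"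
proof -
  define \<beta> where "\<beta> = measure_pmf.prob p B"
  have \<beta>: "\<tau> \<le> \<beta>" "0 \<le> \<beta>" "\<beta> \<le> 1"
    using B by (simp_all add: \<beta>_def)
  have compl: "measure_pmf.prob p (- B) = 1 - \<beta>"
    using measure_pmf.prob_compl[of B p] by (simp add: \<beta>_def Compl_eq_Diff_UNIV)
  have "{\<omega>. \<forall>k<r. \<omega> k \<notin> B} = Pi {..<s} (\<lambda>k. if k < r then - B else UNIV)"
    using r by (auto simp: Pi_def)
  then have "measure_pmf.prob (Pi_pmf {..<s} dflt (\<lambda>_. p)) {\<omega>. \<forall>k<r. \<omega> k \<notin> B} =
      (\<Prod>k<s. measure_pmf.prob p (if k < r then - B else UNIV))"
    by (simp add: measure_Pi_pmf_Pi)
  also have "\<dots> = (\<Prod>k<r. 1 - \<beta>)"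
    by (rule prod.mono_neutral_cong_right) (use r in \<open>auto simp: compl\<close>)
  also have "\<dots> = (1 - \<beta>) ^ r"
    by simp
  also have "\<dots> \<le> exp (- \<tau>) ^ r"
    using \<beta> exp_ge_add_one_self[of "- \<tau>"] by (intro power_mono) auto
  also have "\<dots> = 1 / exp (r * \<tau>)"
    by (simp add: exp_of_nat_mult exp_minus divide_inverse power_inverse)
  also have "\<dots> \<le> 1 / (1 + r * \<tau>)"
    using exp_ge_add_one_self[of "r * \<tau>"] \<tau> by (intro divide_left_mono) (auto intro!: mult_pos_pos add_pos_nonneg)
  finally show ?thesis .
qed

section \<open>The tester\<close>

text \<open>A nonadaptive strategy with accumulator \<open>a\<close>. Answers are stored under the
  column number \<open>j\<close>, not under the coordinate \<open>idx j\<close>, so repeated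
  coordinates cause no clash.\<close>

primrec ask ::
    "(nat \<Rightarrow> nat) \<Rightarrow> (nat \<times> nat) list \<Rightarrow> ((nat \<times> nat \<Rightarrow> bool) \<Rightarrow> bool) \<Rightarrow> (nat \<times> nat \<Rightarrow> bool) \<Rightarrow> strategy" where
  "ask idx [] D a = Decide (D a)"
| "ask idx (q # qs) D a =
     Query (fst q) (idx (snd q)) (ask idx qs D (a(q := False))) (ask idx qs D (a(q := True)))"

lemma verdict_ask:
  "verdict (ask idx qs D a) \<omega> = D (override_on a (\<lambda>(k, j). \<omega> k ! idx j) (set qs))"
proof (induction qs arbitrary: a)
  case (Cons q qs)
  let ?f = "\<lambda>(k, j). \<omega> k ! idx j"
  have "verdict (ask idx (q # qs) D a) \<omega> = verdict (ask idx qs D (a(q := ?f q))) \<omega>"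
    by (cases "?f q") (simp_all add: case_prod_unfold)
  also have "\<dots> = D (override_on (a(q := ?f q)) ?f (set qs))"
    by (rule Cons.IH)
  also have "override_on (a(q := ?f q)) ?f (set qs) = override_on a ?f (set (q # qs))"
    by (auto simp: override_on_def fun_eq_iff)
  finally show ?case .
qed simp

lemma num_queries_ask: "num_queries (ask idx qs D a) = length qs"
  by (induction qs arbitrary: a) auto

lemma legal_ask: "(\<And>k j. (k, j) \<in> set qs \<Longrightarrow> k < s \<and> idx j < n) \<Longrightarrow> legal s n (ask idx qs D a)"
  by (induction qs arbitrary: a) (auto, (metis prod.collapse)+)

definition frequency :: "nat \<Rightarrow> (nat \<Rightarrow> bool) \<Rightarrow> real" where
  "frequency N f = card {k \<in> {..<N}. f k} / N"

text \<open>With accuracy \<open>1 / K\<close>, the union bounds are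
  \<open>60 K^3 * K^2 / (720 K^5) = 1/12\<close> over columns and
  \<open>5 K * K^2 / (60 K^3) = 1/12\<close> over rows. Missing a set of mass above
  \<open>1 / K\<close> in \<open>5 K\<close> rows has probability at most
  \<open>1 / (1 + 5)\<close>. The three add up to \<open>1/3\<close>.\<close>

definition check_rows :: "nat \<Rightarrow> nat" where "check_rows K = 5 * K"
definition column_count :: "nat \<Rightarrow> nat" where "column_count K = 60 * K ^ 3"
definition sample_count :: "nat \<Rightarrow> nat" where "sample_count K = 720 * K ^ 5"

text \<open>
  Row \<open>k\<close> of the matrix \<open>a\<close> is the \<open>k\<close>-th sample restricted to the random coordinates, and
  \<open>\<theta>\<close> is the maximal allowed relative distance to the centre. Only few of the rows take part in the distance check, so that the number of columns
  suffices for a union bound over them.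
\<close>

definition accepts :: "real \<Rightarrow> real \<Rightarrow> nat \<Rightarrow> (nat \<times> nat \<Rightarrow> bool) \<Rightarrow> bool" where
  "accepts \<eta> \<theta> K a \<longleftrightarrow>
     (let c = (\<lambda>j. frequency (sample_count K) (\<lambda>k. a (k, j))) in
       (\<forall>j<column_count K. min (c j) (1 - c j) \<le> \<eta> + 1 / K) \<and>
       (\<forall>k<check_rows K. frequency (column_count K) (\<lambda>j. a (k, j) \<noteq> (c j > 1/2)) \<le> \<theta> + 1 / K))"

definition per_strategy :: "real \<Rightarrow> real \<Rightarrow> nat \<Rightarrow> (nat \<Rightarrow> nat) \<Rightarrow> strategy" where
  "per_strategy \<eta> \<theta> K idx =
     ask idx (List.product [0..<sample_count K] [0..<column_count K]) (accepts \<eta> \<theta> K) (\<lambda>_. False)"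

text \<open>Drawing with replacement keeps the columns independent and makes sense even if
  \<open>column_count K\<close> exceeds \<open>n\<close>.\<close>

definition random_columns :: "nat \<Rightarrow> nat \<Rightarrow> (nat \<Rightarrow> nat) pmf" where
  "random_columns n K = Pi_pmf {..<column_count K} 0 (\<lambda>_. pmf_of_set {..<n})"

definition samples :: "nat \<Rightarrow> bool list pmf \<Rightarrow> (nat \<Rightarrow> bool list) pmf" where
  "samples K P = Pi_pmf {..<sample_count K} [] (\<lambda>_. P)"

definition per_tester :: "real \<Rightarrow> real \<Rightarrow> nat \<Rightarrow> nat \<Rightarrow> strategy pmf" where
  "per_tester \<eta> \<theta> n K = map_pmf (per_strategy \<eta> \<theta> K) (random_columns n K)"

lemma frequency_cong: "(\<And>k. k < N \<Longrightarrow> f k = g k) \<Longrightarrow> frequency N f = frequency N g"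
  unfolding frequency_def by (metis (mono_tags, lifting) Collect_cong lessThan_iff)

lemma check_rows_le: "check_rows K \<le> sample_count K"
proof (cases "K = 0")
  case False
  then have "K ^ 1 \<le> K ^ 5"
    by (intro power_increasing) auto
  then show ?thesis
    unfolding check_rows_def sample_count_def power_one_right by linarith
qed (simp add: check_rows_def)

text \<open>The decision looks only at the part of the table that is actually read, so the initial
  table of \<open>ask\<close> disappears from the verdict.\<close>

lemma accepts_cong:
  assumes "\<And>k j. k < sample_count K \<Longrightarrow> j < column_count K \<Longrightarrow> a (k, j) = b (k, j)"
  shows "accepts \<eta> \<theta> K a = accepts \<eta> \<theta> K b"
proof -
  have c: "frequency (sample_count K) (\<lambda>k. a (k, j)) = frequency (sample_count K) (\<lambda>k. b (k, j))"
    if "j < column_count K" for j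
    using assms that by (intro frequency_cong) auto
  have "frequency (column_count K) (\<lambda>j. a (k, j) \<noteq> (frequency (sample_count K) (\<lambda>k. a (k, j)) > 1/2)) =
      frequency (column_count K) (\<lambda>j. b (k, j) \<noteq> (frequency (sample_count K) (\<lambda>k. b (k, j)) > 1/2))"
    if "k < check_rows K" for k
    using assms that check_rows_le[of K] by (intro frequency_cong) (auto simp: c)
  then show ?thesis
    by (simp add: accepts_def Let_def c)
qed

lemma verdict_per_strategy:
  "verdict (per_strategy \<eta> \<theta> K idx) \<omega> = accepts \<eta> \<theta> K (\<lambda>(k, j). \<omega> k ! idx j)"
  unfolding per_strategy_def verdict_ask by (rule accepts_cong) (auto simp: override_on_def)

lemma num_queries_per_strategy: "num_queries (per_strategy \<eta> \<theta> K idx) = 43200 * K ^ 8"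
  by (simp add: per_strategy_def num_queries_ask sample_count_def column_count_def flip: power_add)

lemma random_columns_less:
  assumes "n \<ge> 1" "idx \<in> set_pmf (random_columns n K)" "j < column_count K"
  shows "idx j < n"
proof -
  have "{..<n} \<noteq> {}"
    using assms(1) by (auto simp: lessThan_empty_iff)
  then show ?thesis
    using assms by (auto simp: random_columns_def set_Pi_pmf PiE_dflt_def)
qed

lemma legal_per_tester:
  assumes "n \<ge> 1" "t \<in> set_pmf (per_tester \<eta> \<theta> n K)"
  shows "legal (sample_count K) n t"
  using assms random_columns_less[OF assms(1)]
  by (auto simp: per_tester_def per_strategy_def intro!: legal_ask)

text \<open>Coins and samples are independent, so the outcome is an event of a product distribution,
  and either factor can be fixed while the other is random.\<close>

lemma pmf_outcome_per_tester:
  "pmf (outcome (sample_count K) (per_tester \<eta> \<theta> n K) P) b =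
     measure_pmf.prob (pair_pmf (random_columns n K) (samples K P))
       {z. accepts \<eta> \<theta> K (\<lambda>(k, j). snd z k ! fst z j) = b}"
proof -
  have "outcome (sample_count K) (per_tester \<eta> \<theta> n K) P =
      map_pmf (\<lambda>z. accepts \<eta> \<theta> K (\<lambda>(k, j). snd z k ! fst z j)) (pair_pmf (random_columns n K) (samples K P))"
    by (simp add: outcome_def per_tester_def samples_def map_pmf_def bind_assoc_pmf bind_return_pmf
        pair_pmf_def verdict_per_strategy)
  then show ?thesis
    by (simp add: pmf_map vimage_def)
qed

section \<open>Deviation events, completeness and soundness\<close>

definition bit_prob :: "bool list pmf \<Rightarrow> nat \<Rightarrow> real" where
  "bit_prob P i = measure_pmf.prob P {x. x ! i}"

lemma prob_bit_neq:
  "measure_pmf.prob P {x. x ! i \<noteq> b} = (if b then 1 - bit_prob P i else bit_prob P i)"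
proof (cases b)
  case True
  have "{x. x ! i \<noteq> b} = space P - {x. x ! i}"
    using True by auto
  then show ?thesis
    using True measure_pmf.prob_compl[of "{x. x ! i}" P] by (simp add: bit_prob_def)
qed (simp add: bit_prob_def)

definition bad_columns :: "nat \<Rightarrow> bool list pmf \<Rightarrow> ((nat \<Rightarrow> nat) \<times> (nat \<Rightarrow> bool list)) set" where
  "bad_columns K P = {z. \<exists>j<column_count K.
     \<bar>frequency (sample_count K) (\<lambda>k. snd z k ! fst z j) - bit_prob P (fst z j)\<bar> > 1 / K}"

text \<open>The reference is a fixed centre \<open>xs\<close>. The estimated centre enters only once
  it is known to agree with \<open>xs\<close> on the sampled columns.\<close>

definition bad_rows :: "nat \<Rightarrow> nat \<Rightarrow> bool list \<Rightarrow> ((nat \<Rightarrow> nat) \<times> (nat \<Rightarrow> bool list)) set" where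
  "bad_rows n K xs = {z. \<exists>k<check_rows K.
     \<bar>frequency (column_count K) (\<lambda>j. snd z k ! fst z j \<noteq> xs ! fst z j) - rel_hamming n (snd z k) xs\<bar> > 1 / K}"

text \<open>With the columns fixed, each estimate is a frequency over independent samples; a union
  bound over the columns follows.\<close>

lemma prob_bad_columns:
  assumes K: "K \<ge> 1"
  shows "measure_pmf.prob (pair_pmf (random_columns n K) (samples K P)) (bad_columns K P) \<le> 1 / 12"
  unfolding bad_columns_def
proof (rule prob_pair_pmf_le)
  fix idx
  have "measure_pmf.prob (samples K P) {\<omega>. \<exists>j<column_count K.
      \<bar>frequency (sample_count K) (\<lambda>k. \<omega> k ! idx j) - bit_prob P (idx j)\<bar> > 1 / K}
    \<le> column_count K * (1 / (sample_count K * (1 / K)\<^sup>2))"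
  proof (rule prob_bex_le)
    fix j
    show "measure_pmf.prob (samples K P)
        {\<omega>. \<bar>frequency (sample_count K) (\<lambda>k. \<omega> k ! idx j) - bit_prob P (idx j)\<bar> > 1 / K}
      \<le> 1 / (sample_count K * (1 / K)\<^sup>2)"
      using prob_frequency_deviation_le[of "sample_count K" "1 / K" "[]" P "{x. x ! idx j}"] K
      by (simp add: samples_def frequency_def bit_prob_def sample_count_def)
  qed
  also have "\<dots> = 1 / 12"
    using K by (simp add: column_count_def sample_count_def field_simps eval_nat_numeral)
  finally show "measure_pmf.prob (samples K P) {\<omega>. \<exists>j<column_count K.
      \<bar>frequency (sample_count K) (\<lambda>k. \<omega> k ! idx j) - bit_prob P (idx j)\<bar> > 1 / K} \<le> 1 / 12" .
qed simp

text \<open>Here the samples are fixed and the columns are random: the distance of a row to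
  \<open>xs\<close> is the probability that a uniform coordinate is an error.\<close>

lemma prob_bad_rows:
  assumes K: "K \<ge> 1" and n: "n \<ge> 1"
  shows "measure_pmf.prob (pair_pmf (random_columns n K) (samples K P)) (bad_rows n K xs) \<le> 1 / 12"
  unfolding bad_rows_def
proof (rule prob_pair_pmf_le')
  fix \<omega>
  have ne: "{..<n} \<noteq> {}"
    using n by (auto simp: lessThan_empty_iff)
  have "measure_pmf.prob (random_columns n K) {idx. \<exists>k<check_rows K.
      \<bar>frequency (column_count K) (\<lambda>j. \<omega> k ! idx j \<noteq> xs ! idx j) - rel_hamming n (\<omega> k) xs\<bar> > 1 / K}
    \<le> check_rows K * (1 / (column_count K * (1 / K)\<^sup>2))"
  proof (rule prob_bex_le)
    fix k
    have "measure_pmf.prob (pmf_of_set {..<n}) {i. \<omega> k ! i \<noteq> xs ! i} = rel_hamming n (\<omega> k) xs"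
      using ne by (simp add: measure_pmf_of_set rel_hamming_def diff_set_def Int_def)
    then show "measure_pmf.prob (random_columns n K)
        {idx. \<bar>frequency (column_count K) (\<lambda>j. \<omega> k ! idx j \<noteq> xs ! idx j) - rel_hamming n (\<omega> k) xs\<bar> > 1 / K}
      \<le> 1 / (column_count K * (1 / K)\<^sup>2)"
      using prob_frequency_deviation_le[of "column_count K" "1 / K" 0 "pmf_of_set {..<n}"
          "{i. \<omega> k ! i \<noteq> xs ! i}"] K
      by (simp add: random_columns_def frequency_def column_count_def)
  qed
  also have "\<dots> = 1 / 12"
    using K by (simp add: column_count_def check_rows_def field_simps eval_nat_numeral)
  finally show "measure_pmf.prob (random_columns n K) {idx. \<exists>k<check_rows K.
      \<bar>frequency (column_count K) (\<lambda>j. \<omega> k ! idx j \<noteq> xs ! idx j) - rel_hamming n (\<omega> k) xs\<bar> > 1 / K} \<le> 1 / 12" .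
qed simp

text \<open>Without a deviation, each estimate is within \<open>\<eta> + 1 / K < 1/2\<close> of the
  centre's bit, so the estimated centre is correct on the sampled columns and both checks pass.
  Rejection thus has probability at most \<open>1/12 + 1/12\<close>.\<close>

lemma per_tester_complete:
  assumes K: "K \<ge> 1" "\<eta> + 2 / K < 1/2" and n: "n \<ge> 1" and \<eta>: "0 \<le> \<eta>"
    and P: "P \<in> D_per \<eta> \<delta> n"
  shows "pmf (outcome (sample_count K) (per_tester \<eta> (\<lfloor>\<delta> * n\<rfloor> / n) n K) P) True \<ge> 2/3"
proof -
  let ?\<theta> = "\<lfloor>\<delta> * n\<rfloor> / n"
  let ?M = "pair_pmf (random_columns n K) (samples K P)"
  let ?A = "\<lambda>z. accepts \<eta> ?\<theta> K (\<lambda>(k, j). snd z k ! fst z j)"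
  have "0 < 1 / real K"
    using K by simp
  obtain xs where "P \<in> D_per_at \<eta> \<delta> n xs"
    using P by (auto simp: D_per_def)
  then have err: "\<And>i. i < n \<Longrightarrow> (if xs ! i then 1 - bit_prob P i else bit_prob P i) \<le> \<eta>"
    and AE: "\<And>x. x \<in> set_pmf P \<Longrightarrow> real (card (diff_set n x xs)) \<le> \<delta> * n"
    unfolding D_per_at_def prob_bit_neq by (auto simp: measure_pmf.prob_eq_1 AE_measure_pmf_iff)
  have dist: "rel_hamming n x xs \<le> ?\<theta>" if "x \<in> set_pmf P" for x
  proof -
    \<comment> \<open>The number of errors is an integer, so the bound \<open>\<delta> * n\<close>
      sharpens to its floor.\<close>
    have "int (card (diff_set n x xs)) \<le> \<lfloor>\<delta> * n\<rfloor>"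
      using AE[OF that] by (simp add: le_floor_iff)
    then have "real (card (diff_set n x xs)) \<le> real_of_int \<lfloor>\<delta> * n\<rfloor>"
      by linarith
    then show ?thesis
      by (simp add: rel_hamming_def divide_right_mono)
  qed
  have good: "?A z" if z: "z \<in> set_pmf ?M" "z \<notin> bad_columns K P" "z \<notin> bad_rows n K xs" for z
  proof -
    define c where "c = (\<lambda>j. frequency (sample_count K) (\<lambda>k. snd z k ! fst z j))"
    have c: "min (c j) (1 - c j) \<le> \<eta> + 1 / K" "(c j > 1/2) = xs ! fst z j" if "j < column_count K" for j
    proof -
      have "fst z j < n"
        using random_columns_less[OF n _ that] z(1) by auto
      from err[OF this] have
        "if xs ! fst z j then 1 - bit_prob P (fst z j) \<le> \<eta> else bit_prob P (fst z j) \<le> \<eta>"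
        by (auto split: if_splits)
      moreover have "\<bar>c j - bit_prob P (fst z j)\<bar> \<le> 1 / K"
        using z(2) that by (auto simp: bad_columns_def c_def)
      ultimately show "min (c j) (1 - c j) \<le> \<eta> + 1 / K" "(c j > 1/2) = xs ! fst z j"
        using K(2) \<open>0 < 1 / real K\<close> by (auto simp: min_def abs_le_iff split: if_splits)
    qed
    have "frequency (column_count K) (\<lambda>j. snd z k ! fst z j \<noteq> (c j > 1/2)) \<le> ?\<theta> + 1 / K"
      if k: "k < check_rows K" for k
    proof -
      have "k < sample_count K"
        using k check_rows_le[of K] by linarith
      then have "snd z k \<in> set_pmf P"
        using z(1) by (auto simp: samples_def set_Pi_pmf PiE_dflt_def)
      moreover have "\<bar>frequency (column_count K) (\<lambda>j. snd z k ! fst z j \<noteq> xs ! fst z j) -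
          rel_hamming n (snd z k) xs\<bar> \<le> 1 / K"
        using z(3) k by (auto simp: bad_rows_def)
      moreover have "frequency (column_count K) (\<lambda>j. snd z k ! fst z j \<noteq> (c j > 1/2)) =
          frequency (column_count K) (\<lambda>j. snd z k ! fst z j \<noteq> xs ! fst z j)"
        by (rule frequency_cong) (simp only: c)
      ultimately show ?thesis
        using dist[of "snd z k"] by linarith
    qed
    then show ?thesis
      using c(1) by (auto simp: accepts_def Let_def c_def)
  qed
  \<comment> \<open>Restricting to the support makes \<open>good\<close> applicable: there columns
    are below \<open>n\<close> and rows are outcomes of \<open>P\<close>.\<close>
  have "measure_pmf.prob ?M {z. ?A z = False} = measure_pmf.prob ?M ({z. \<not> ?A z} \<inter> set_pmf ?M)"
    by (simp add: measure_Int_set_pmf del: set_pair_pmf)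
  also have "\<dots> \<le> 1/12 + 1/12 + 0"
    by (rule prob_Un3_le[where A = "bad_columns K P" and B = "bad_rows n K xs" and C = "{}"])
      (use good K n prob_bad_columns prob_bad_rows in auto)
  finally have "pmf (outcome (sample_count K) (per_tester \<eta> ?\<theta> n K) P) False \<le> 1/3"
    unfolding pmf_outcome_per_tester by simp
  then show ?thesis
    by (simp add: pmf_False_conv_True)
qed

text \<open>By \<open>close_to_D_per_at\<close> with \<open>\<tau> = 1 / K\<close>, a far
  \<open>P\<close> has many bad coordinates or often yields far samples. Acceptance without a
  deviation requires missing all of this evidence, which has probability at most
  \<open>1/6\<close>.\<close>

lemma per_tester_sound:
  assumes K: "K \<ge> 1" "\<eta> + 2 / K < 1/2" "5 / K \<le> \<epsilon>" and n: "n \<ge> 1"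
    and \<eta>: "0 \<le> \<eta>" and \<delta>: "0 \<le> \<delta>"
    and P: "P \<in> distributions n" "far_from n \<epsilon> P (D_per \<eta> \<delta> n)"
  shows "pmf (outcome (sample_count K) (per_tester \<eta> (\<lfloor>\<delta> * n\<rfloor> / n) n K) P) False \<ge> 2/3"
proof -
  let ?\<theta> = "\<lfloor>\<delta> * n\<rfloor> / n"
  let ?M = "pair_pmf (random_columns n K) (samples K P)"
  let ?A = "\<lambda>z. accepts \<eta> ?\<theta> K (\<lambda>(k, j). snd z k ! fst z j)"
  have K0: "0 < 1 / real K"
    using K by simp
  have ne: "{..<n} \<noteq> {}"
    using n by (auto simp: lessThan_empty_iff)
  \<comment> \<open>The coordinatewise majority; a tie gives \<open>False\<close>, as in the test
    \<open>c > 1/2\<close> of the tester.\<close>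
  define xs where "xs = map (\<lambda>i. bit_prob P i > 1/2) [0..<n]"
  have xs: "xs \<in> cube n"
    by (simp add: xs_def cube_def)
  have xs_nth: "xs ! i \<longleftrightarrow> bit_prob P i > 1/2" if "i < n" for i
    using that by (simp add: xs_def)
  define Bad where "Bad = {i. i < n \<and> measure_pmf.prob P {x. x ! i \<noteq> xs ! i} > \<eta> + 2 * (1 / K)}"
  define F where "F = {x. rel_hamming n x xs > ?\<theta> + 2 * (1 / K)}"
  have Bad_iff: "i \<in> Bad \<longleftrightarrow> i < n \<and> (if xs ! i then 1 - bit_prob P i else bit_prob P i) > \<eta> + 2 * (1 / K)" for i
    unfolding Bad_def prob_bit_neq by simp
  \<comment> \<open>Passing puts \<open>c\<close> within \<open>\<eta> + 1 / K < 1/2 - 1 / K\<close>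
    of 0 or 1. A deviation of \<open>1 / K\<close> cannot cross \<open>1/2\<close>, so
    \<open>c\<close> and the true bit probability have the same majority, with error at most
    \<open>\<eta> + 2 / K\<close>.\<close>
  have column: "(c > 1/2) = xs ! i" "i \<notin> Bad"
    if "i < n" "\<bar>c - bit_prob P i\<bar> \<le> 1 / K" "min c (1 - c) \<le> \<eta> + 1 / K" for c i
    using that K(2) by (auto simp: Bad_iff xs_nth min_def abs_le_iff split: if_splits)
  have acc: "(\<forall>j<column_count K. fst z j \<notin> Bad) \<and> (\<forall>k<check_rows K. snd z k \<notin> F)"
    if z: "z \<in> set_pmf ?M" "z \<notin> bad_columns K P" "z \<notin> bad_rows n K xs" "?A z" for z
  proof -
    define c where "c = (\<lambda>j. frequency (sample_count K) (\<lambda>k. snd z k ! fst z j))"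
    have c: "(c j > 1/2) = xs ! fst z j" "fst z j \<notin> Bad" if "j < column_count K" for j
    proof -
      have "fst z j < n"
        using random_columns_less[OF n _ that] z(1) by auto
      moreover have "\<bar>c j - bit_prob P (fst z j)\<bar> \<le> 1 / K"
        using z(2) that by (auto simp: bad_columns_def c_def)
      moreover have "min (c j) (1 - c j) \<le> \<eta> + 1 / K"
        using z(4) that by (simp add: accepts_def Let_def c_def)
      ultimately show "(c j > 1/2) = xs ! fst z j" "fst z j \<notin> Bad"
        using column by blast+
    qed
    have "snd z k \<notin> F" if k: "k < check_rows K" for k
    proof -
      have "frequency (column_count K) (\<lambda>j. snd z k ! fst z j \<noteq> (c j > 1/2)) \<le> ?\<theta> + 1 / K"
        using z(4) k by (simp add: accepts_def Let_def c_def)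
      moreover have "\<bar>frequency (column_count K) (\<lambda>j. snd z k ! fst z j \<noteq> xs ! fst z j) -
          rel_hamming n (snd z k) xs\<bar> \<le> 1 / K"
        using z(3) k by (auto simp: bad_rows_def)
      moreover have "frequency (column_count K) (\<lambda>j. snd z k ! fst z j \<noteq> (c j > 1/2)) =
          frequency (column_count K) (\<lambda>j. snd z k ! fst z j \<noteq> xs ! fst z j)"
        by (rule frequency_cong) (simp only: c)
      ultimately show ?thesis
        by (simp add: F_def)
    qed
    then show ?thesis
      using c by blast
  qed
  define C where "C = {z :: (nat \<Rightarrow> nat) \<times> (nat \<Rightarrow> bool list).
    (\<forall>j<column_count K. fst z j \<notin> Bad) \<and> (\<forall>k<check_rows K. snd z k \<notin> F)}"
  \<comment> \<open>Otherwise the repair would yield a member of the property at distance at most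
    \<open>5 / K \<le> \<epsilon>\<close>.\<close>
  have "card Bad > 1 / K * n \<or> measure_pmf.prob P F > 1 / K"
  proof (rule ccontr)
    assume "\<not> ?thesis"
    then have "\<exists>Q\<in>D_per_at \<eta> \<delta> n xs. dist_distance n P Q \<le> 5 * (1 / K)"
      using K0 P(1) xs n \<eta> \<delta> by (intro close_to_D_per_at) (auto simp: Bad_def F_def not_less)
    then show False
      using P(2) K(3) xs by (force simp: far_from_def D_per_def)
  qed
  then have C: "measure_pmf.prob ?M C \<le> 1/6"
  proof
    assume "card Bad > 1 / K * n"
    moreover have "measure_pmf.prob (pmf_of_set {..<n}) Bad = card Bad / n"
    proof -
      have "{..<n} \<inter> Bad = Bad"
        by (auto simp: Bad_def)
      then show ?thesis
        using ne by (simp add: measure_pmf_of_set)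
    qed
    ultimately have "1 / K \<le> measure_pmf.prob (pmf_of_set {..<n}) Bad"
      using n by (simp add: pos_le_divide_eq less_imp_le)
    from prob_all_avoid_le[OF order_refl this K0, of "column_count K" 0]
    have 1: "measure_pmf.prob (random_columns n K) {idx. \<forall>j<column_count K. idx j \<notin> Bad} \<le>
        1 / (1 + column_count K * (1 / K))"
      by (simp add: random_columns_def)
    have "5 \<le> column_count K * (1 / real K)"
    proof -
      have "1 \<le> real K ^ 2"
        using K(1) by simp
      then show ?thesis
        using K(1) by (simp add: column_count_def field_simps eval_nat_numeral)
    qed
    then have "1 / (1 + column_count K * (1 / real K)) \<le> 1 / 6"
      using frac_le[of 1 1 6 "1 + column_count K * (1 / real K)"] by linarith
    with 1 have 2: "measure_pmf.prob (random_columns n K) {idx. \<forall>j<column_count K. idx j \<notin> Bad} \<le> 1 / 6"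
      by linarith
    have "measure_pmf.prob ?M C \<le> measure_pmf.prob ?M {z. \<forall>j<column_count K. fst z j \<notin> Bad}"
      by (rule measure_pmf.finite_measure_mono) (auto simp: C_def)
    also have "\<dots> \<le> 1 / 6"
      using 2 by (intro prob_pair_pmf_le'[where R = "\<lambda>idx _. \<forall>j<column_count K. idx j \<notin> Bad"]) auto
    finally show ?thesis .
  next
    assume "measure_pmf.prob P F > 1 / K"
    then have 1: "measure_pmf.prob (samples K P) {\<omega>. \<forall>k<check_rows K. \<omega> k \<notin> F} \<le> 1 / 6"
      using prob_all_avoid_le[OF check_rows_le[of K] _ K0, of P F "[]"] K
      by (simp add: samples_def check_rows_def)
    have "measure_pmf.prob ?M C \<le> measure_pmf.prob ?M {z. \<forall>k<check_rows K. snd z k \<notin> F}"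
      by (rule measure_pmf.finite_measure_mono) (auto simp: C_def)
    also have "\<dots> \<le> 1 / 6"
      using 1 by (intro prob_pair_pmf_le[where R = "\<lambda>_ \<omega>. \<forall>k<check_rows K. \<omega> k \<notin> F"]) auto
    finally show ?thesis .
  qed
  have "measure_pmf.prob ?M {z. ?A z = True} = measure_pmf.prob ?M ({z. ?A z} \<inter> set_pmf ?M)"
    by (simp add: measure_Int_set_pmf del: set_pair_pmf)
  also have "\<dots> \<le> 1/12 + 1/12 + 1/6"
    by (rule prob_Un3_le[where A = "bad_columns K P" and B = "bad_rows n K xs" and C = C])
      (use acc K n C prob_bad_columns prob_bad_rows in \<open>auto simp: C_def\<close>)
  finally have "pmf (outcome (sample_count K) (per_tester \<eta> ?\<theta> n K) P) True \<le> 1/3"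
    unfolding pmf_outcome_per_tester by simp
  then show ?thesis
    by (simp add: pmf_False_conv_True)
qed

theorem theorem4p1:
  fixes \<eta> \<delta> :: real
  assumes "0 \<le> \<eta>" and "\<eta> < 1/2" and "0 \<le> \<delta>" and "\<delta> \<le> 1"
  shows "\<exists>p :: real poly. DoHO_testable_with (D_per \<eta> \<delta>) (\<lambda>n \<epsilon>. poly p (1 / \<epsilon>))"
proof -
  \<comment> \<open>\<open>K \<ge> L\<close> gives \<open>3 / K \<le> 1/2 - \<eta>\<close>, hence
    the strict margin \<open>\<eta> + 2 / K < 1/2\<close>; the summand \<open>5 / \<epsilon>\<close>
    in \<open>K\<close> gives \<open>5 / K \<le> \<epsilon>\<close>.\<close>
  define L where "L = 3 / (1/2 - \<eta>)"
  define K where "K = (\<lambda>\<epsilon>::real. nat \<lceil>5 / \<epsilon> + L\<rceil>)"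
  define S where "S = (\<lambda>(n::nat) \<epsilon>. sample_count (K \<epsilon>))"
  define T where "T = (\<lambda>n \<epsilon>. per_tester \<eta> (\<lfloor>\<delta> * real n\<rfloor> / n) n (K \<epsilon>))"
  \<comment> \<open>The matrix has \<open>720 K^5 * 60 K^3 = 43200 K^8\<close> entries, and
    \<open>K\<close> is at most the linear polynomial \<open>[:L + 1, 5:]\<close> at
    \<open>1 / \<epsilon>\<close>. Its coefficients depend on \<open>\<eta>\<close> only.\<close>
  define p where "p = smult 43200 ([:L + 1, 5:] ^ 8)"
  have L: "0 < L"
    using assms by (simp add: L_def)
  have K: "5 / \<epsilon> + L \<le> K \<epsilon>" "K \<epsilon> \<le> 5 / \<epsilon> + L + 1" "K \<epsilon> \<ge> 1" "\<eta> + 2 / K \<epsilon> < 1/2" "5 / K \<epsilon> \<le> \<epsilon>"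
    if "\<epsilon> > 0" for \<epsilon>
  proof -
    have pos: "0 < 5 / \<epsilon>"
      using that by simp
    show 1: "5 / \<epsilon> + L \<le> K \<epsilon>" and "K \<epsilon> \<le> 5 / \<epsilon> + L + 1"
      using pos L unfolding K_def by linarith+
    with pos L have K0: "0 < real (K \<epsilon>)" and le: "5 / \<epsilon> \<le> K \<epsilon>" "L \<le> K \<epsilon>"
      by linarith+
    then show "K \<epsilon> \<ge> 1"
      by simp
    show "5 / K \<epsilon> \<le> \<epsilon>"
      using le(1) K0 that by (simp add: field_simps)
    have "3 / K \<epsilon> \<le> 1/2 - \<eta>"
      using le(2) K0 assms by (simp add: L_def field_simps)
    moreover have "2 / K \<epsilon> < 3 / K \<epsilon>"
      using K0 by (simp add: divide_strict_right_mono)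
    ultimately show "\<eta> + 2 / K \<epsilon> < 1/2"
      by linarith
  qed
  have "DoHO_tester (D_per \<eta> \<delta>) S T"
    unfolding DoHO_tester_def S_def T_def
  proof (intro allI impI conjI ballI)
    fix n :: nat and \<epsilon> :: real
    assume n: "n \<ge> 1" and \<epsilon>: "\<epsilon> > 0"
    let ?T = "per_tester \<eta> (\<lfloor>\<delta> * real n\<rfloor> / n) n (K \<epsilon>)"
    show "legal (sample_count (K \<epsilon>)) n t" if "t \<in> set_pmf ?T" for t
      using n that by (rule legal_per_tester)
    show "pmf (outcome (sample_count (K \<epsilon>)) ?T P) True \<ge> 2/3" if "P \<in> D_per \<eta> \<delta> n" for P
      using K(3,4)[OF \<epsilon>] n assms(1) that by (rule per_tester_complete)
    show "pmf (outcome (sample_count (K \<epsilon>)) ?T P) False \<ge> 2/3"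
      if "P \<in> distributions n" "far_from n \<epsilon> P (D_per \<eta> \<delta> n)" for P
      using K(3-5)[OF \<epsilon>] n assms(1,3) that by (rule per_tester_sound)
  qed
  moreover have "query_complexity_le T (\<lambda>n \<epsilon>. poly p (1 / \<epsilon>))"
    unfolding query_complexity_le_def
  proof (intro allI impI ballI)
    fix n :: nat and \<epsilon> :: real and t
    assume \<epsilon>: "\<epsilon> > 0" and t: "t \<in> set_pmf (T n \<epsilon>)"
    have "num_queries t = 43200 * K \<epsilon> ^ 8"
      using t by (auto simp: T_def per_tester_def num_queries_per_strategy)
    then have "real (num_queries t) = 43200 * real (K \<epsilon>) ^ 8"
      by simp
    also have "\<dots> \<le> 43200 * (5 / \<epsilon> + L + 1) ^ 8"
      using K(2)[OF \<epsilon>] by (intro mult_left_mono power_mono) auto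
    also have "\<dots> = poly p (1 / \<epsilon>)"
      by (simp add: p_def algebra_simps)
    finally show "real (num_queries t) \<le> poly p (1 / \<epsilon>)" .
  qed
  ultimately show ?thesis
    unfolding DoHO_testable_with_def by blast
qed

end
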